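(* As $k\to\infty$, $\big\lvert\{R_{\chi}(G):\ G \text{ a graph with } \chi(G)=k\}\big\rvert=\Omega(k)$; that is, there are constants $c>0$ and $k_0\in\mathbb{N}$ such that for every integer $k\ge k_0$ the set of values $R_\chi(G)$, taken over all graphs $G$ with chromatic number $k$, has at least $ck$ elements.
   Context: All graphs are finite and simple. $\chi(G)$ is the chromatic number of $G$. A copy of $G$ is a graph obtained by relabeling the vertices of $G$; copies are sought as (not necessarily induced) subgraphs. For a graph $G$ containing at least one edge, the chromatic Ramsey number $R_{\chi}(G)$ is the smallest integer $N$ such that there exists a graph $F$ with $\chi(F)=N$ for which every $2$-coloring of the edges of $F$ results in a monochromatic copy of $G$. *)

theory Defs
  imports Complex_Main "HOL-Library.Ramsey"
begin

type_synonym 'a graph = "'a set \<times> 'a set set"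

abbreviation verts :: "'a graph \<Rightarrow> 'a set" where "verts \<equiv> fst"
abbreviation edges :: "'a graph \<Rightarrow> 'a set set" where "edges \<equiv> snd"

text \<open>Edges are 2-element subsets of the vertex set.\<close>

definition simple_graph :: "'a graph \<Rightarrow> bool" where
  "simple_graph G \<longleftrightarrow> finite (verts G) \<and> edges G \<subseteq> nsets (verts G) 2"

definition proper_colouring :: "'a graph \<Rightarrow> nat \<Rightarrow> ('a \<Rightarrow> nat) \<Rightarrow> bool" where
  "proper_colouring G n f \<longleftrightarrow>
     f ` verts G \<subseteq> {..<n} \<and> (\<forall>u v. {u, v} \<in> edges G \<longrightarrow> f u \<noteq> f v)"

definition chromatic_number :: "'a graph \<Rightarrow> nat" where
  "chromatic_number G = (LEAST n. \<exists>f. proper_colouring G n f)"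

definition relabel :: "('a \<Rightarrow> 'b) \<Rightarrow> 'a graph \<Rightarrow> 'b graph" where
  "relabel f G = (f ` verts G, (\<lambda>e. f ` e) ` edges G)"

definition copy_of :: "'b graph \<Rightarrow> 'a graph \<Rightarrow> bool" where
  "copy_of H G \<longleftrightarrow> (\<exists>f. inj_on f (verts G) \<and> H = relabel f G)"

definition subgraph_of :: "'a graph \<Rightarrow> 'a graph \<Rightarrow> bool" where
  "subgraph_of H F \<longleftrightarrow> verts H \<subseteq> verts F \<and> edges H \<subseteq> edges F"

text \<open>A 2-colouring is a total function on sets of vertices, of which only the values on the
  edges of \<open>F\<close> are used.\<close>

definition ramsey_for :: "'b graph \<Rightarrow> 'a graph \<Rightarrow> bool" where
  "ramsey_for F G \<longleftrightarrow>
     (\<forall>c :: 'b set \<Rightarrow> bool. \<exists>H. copy_of H G \<and> subgraph_of H F \<and>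
        (\<exists>b. \<forall>e\<in>edges H. c e = b))"

text \<open>The set minimised over is nonempty by Ramsey's theorem. Every finite graph is a relabelling
  of one with vertices in \<^typ>\<open>nat\<close>, so it suffices to let \<open>F\<close> range over such graphs. The value
  is only meaningful when \<open>G\<close> has at least one edge. For \<open>k \<ge> 2\<close> the values over all \<open>G\<close> of
  chromatic number \<open>k\<close> are bounded by the Ramsey number of the complete graph on \<open>k\<close> vertices, so
  they form a finite set and \<^const>\<open>card\<close> counts them.\<close>

definition chromatic_ramsey :: "'a graph \<Rightarrow> nat" where
  "chromatic_ramsey G =
     (LEAST N. \<exists>F :: nat graph. simple_graph F \<and> chromatic_number F = N \<and> ramsey_for F G)"

end

theory Submission
  imports Defs "HOL-Library.Nat_Bijection"
begin

text \<open>By Burr, Erdos and Lovasz, \<open>R\<^sub>\<chi>(G)\<close> is the least \<open>n\<close> such that every 2-colouring of the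
  complete graph on \<open>n\<close> vertices has a colour class into which \<open>G\<close> maps homomorphically. There is a
  graph \<open>G\<close> with \<open>\<chi>(G) = k\<close> and \<open>R\<^sub>\<chi>(G) \<le> k\<^sup>2\<close>: every 2-colouring on \<open>k\<^sup>2\<close> vertices has a class of
  Hall ratio at least \<open>k\<close>, and by Zhu's argument for the fractional Hedetniemi conjecture the tensor
  product of such classes still has Hall ratio, hence chromatic number, at least \<open>k\<close>.

  Let \<open>U\<^sub>i\<close> be the disjoint union of \<open>G\<close> and an \<open>i\<close>-clique, which has chromatic number \<open>k\<close> for
  \<open>i \<le> k\<close>. Once \<open>R\<^sub>\<chi>(U\<^sub>i) > k\<^sup>2\<close>, an extremal colouring for \<open>U\<^sub>i\<close> has a class that contains \<open>G\<close> but
  no \<open>i\<close>-clique, and joining a new vertex to everything in this colour gives a colouring that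
  avoids \<open>U\<^sub>i\<^sub>+\<^sub>1\<close>, so \<open>R\<^sub>\<chi>(U\<^sub>i) < R\<^sub>\<chi>(U\<^sub>i\<^sub>+\<^sub>1)\<close>. As diagonal Ramsey numbers grow faster than
  quadratically, this holds for all \<open>i\<close> with \<open>k / 2 < i \<le> k\<close> when \<open>k\<close> is large.\<close>

subsection \<open>Homomorphisms and the arrow relation\<close>

definition complete_on :: "'a set \<Rightarrow> 'a graph" where
  "complete_on A = (A, nsets A 2)"

definition colour_class :: "nat \<Rightarrow> (nat set \<Rightarrow> bool) \<Rightarrow> bool \<Rightarrow> nat graph" where
  "colour_class n c b = ({..<n}, {e \<in> nsets {..<n} 2. c e = b})"

definition maps_to :: "'a graph \<Rightarrow> 'b graph \<Rightarrow> bool" where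
  "maps_to G H \<longleftrightarrow>
     (\<exists>f. f ` verts G \<subseteq> verts H \<and> (\<forall>u v. {u, v} \<in> edges G \<longrightarrow> {f u, f v} \<in> edges H))"

definition arrows :: "nat \<Rightarrow> 'a graph \<Rightarrow> bool" where
  "arrows n G \<longleftrightarrow> (\<forall>c. \<exists>b. maps_to G (colour_class n c b))"

lemma maps_toI:
  assumes "\<And>v. v \<in> verts G \<Longrightarrow> f v \<in> verts H"
    and "\<And>u v. {u, v} \<in> edges G \<Longrightarrow> {f u, f v} \<in> edges H"
  shows "maps_to G H"
  using assms unfolding maps_to_def by blast

lemma maps_toE:
  assumes "maps_to G H"
  obtains f where "\<And>v. v \<in> verts G \<Longrightarrow> f v \<in> verts H"
    and "\<And>u v. {u, v} \<in> edges G \<Longrightarrow> {f u, f v} \<in> edges H"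
  using assms unfolding maps_to_def by blast

lemma maps_to_trans:
  assumes "maps_to G H" "maps_to H K"
  shows "maps_to G K"
proof -
  obtain f where f: "\<And>v. v \<in> verts G \<Longrightarrow> f v \<in> verts H"
    "\<And>u v. {u, v} \<in> edges G \<Longrightarrow> {f u, f v} \<in> edges H"
    using maps_toE[OF assms(1)] by metis
  obtain g where g: "\<And>v. v \<in> verts H \<Longrightarrow> g v \<in> verts K"
    "\<And>u v. {u, v} \<in> edges H \<Longrightarrow> {g u, g v} \<in> edges K"
    using maps_toE[OF assms(2)] by metis
  show ?thesis
    by (rule maps_toI[where f = "g \<circ> f"]) (auto simp: f g)
qed

lemma maps_to_mono:
  assumes "verts G \<subseteq> verts H" "edges G \<subseteq> edges H"
  shows "maps_to G H"
  by (rule maps_toI[where f = id]) (use assms in auto)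

lemma simple_graph_edgeD:
  assumes "simple_graph G" "{u, v} \<in> edges G"
  shows "u \<in> verts G" "v \<in> verts G" "u \<noteq> v"
  using assms unfolding simple_graph_def
  by (metis (no_types, lifting) doubleton_in_nsets_2 subsetD)+

lemma simple_graph_edgeE:
  assumes "simple_graph G" "e \<in> edges G"
  obtains u v where "e = {u, v}" "u \<in> verts G" "v \<in> verts G" "u \<noteq> v"
  using assms unfolding simple_graph_def by (meson nsets2_E subsetD)

lemma relabel_edgeE:
  assumes "simple_graph G" "e \<in> edges (relabel f G)"
  obtains u v where "{u, v} \<in> edges G" "e = {f u, f v}"
proof -
  obtain e' where e': "e' \<in> edges G" "e = f ` e'"
    using assms(2) by (auto simp: relabel_def)
  obtain u v where "e' = {u, v}"
    using simple_graph_edgeE[OF assms(1) e'(1)] by blast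
  with e' show thesis
    by (intro that[of u v]) auto
qed

lemma simple_complete_on: "finite A \<Longrightarrow> simple_graph (complete_on A)"
  by (simp add: simple_graph_def complete_on_def)

lemma simple_colour_class: "simple_graph (colour_class n c b)"
  by (auto simp: simple_graph_def colour_class_def)

lemma maps_to_complete_iff:
  "maps_to G (complete_on {..<n}) \<longleftrightarrow> (\<exists>f. proper_colouring G n f)"
  if "simple_graph G"
proof
  assume "maps_to G (complete_on {..<n})"
  then obtain f where "\<And>v. v \<in> verts G \<Longrightarrow> f v \<in> {..<n}"
    "\<And>u v. {u, v} \<in> edges G \<Longrightarrow> {f u, f v} \<in> nsets {..<n} 2"
    unfolding maps_to_def complete_on_def by (auto simp: image_subset_iff)
  then show "\<exists>f. proper_colouring G n f"
    unfolding proper_colouring_def by (metis doubleton_in_nsets_2 image_subsetI)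
next
  assume "\<exists>f. proper_colouring G n f"
  then obtain f where f: "proper_colouring G n f" by blast
  show "maps_to G (complete_on {..<n})"
    by (rule maps_toI[where f = f])
      (use f simple_graph_edgeD[OF that] in \<open>auto simp: proper_colouring_def complete_on_def image_subset_iff\<close>)
qed

text \<open>The minimum is attained, since an injective numbering of the vertices is a proper
  colouring; composing with inclusions of complete graphs then gives every larger
  \<open>n\<close>.\<close>

lemma chromatic_number_le_iff:
  assumes "simple_graph G"
  shows "chromatic_number G \<le> n \<longleftrightarrow> maps_to G (complete_on {..<n})"
proof
  obtain r where r: "bij_betw r (verts G) {0..<card (verts G)}"
    using assms ex_bij_betw_finite_nat unfolding simple_graph_def by blast
  have "proper_colouring G (card (verts G)) r"
    using r simple_graph_edgeD[OF assms]
    by (auto simp: proper_colouring_def bij_betw_def lessThan_atLeast0 inj_on_eq_iff)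
  then have "\<exists>f. proper_colouring G (chromatic_number G) f"
    unfolding chromatic_number_def
    by (intro LeastI[where P = "\<lambda>n. \<exists>f. proper_colouring G n f"] exI[of _ r])
  then have *: "maps_to G (complete_on {..<chromatic_number G})"
    by (simp add: maps_to_complete_iff[OF assms])
  assume "chromatic_number G \<le> n"
  then have "maps_to (complete_on {..<chromatic_number G}) (complete_on {..<n})"
    by (intro maps_to_mono) (auto simp: complete_on_def nsets_mono)
  with * show "maps_to G (complete_on {..<n})"
    by (rule maps_to_trans)
next
  assume "maps_to G (complete_on {..<n})"
  then show "chromatic_number G \<le> n"
    unfolding maps_to_complete_iff[OF assms] chromatic_number_def by (rule Least_le)
qed

lemma optimal_colouringE:
  assumes "simple_graph G"
  obtains g where "\<And>v. v \<in> verts G \<Longrightarrow> g v < chromatic_number G"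
    and "\<And>u v. {u, v} \<in> edges G \<Longrightarrow> g u \<noteq> g v"
proof -
  obtain g where "proper_colouring G (chromatic_number G) g"
    using chromatic_number_le_iff[OF assms] maps_to_complete_iff[OF assms] by blast
  then show thesis
    by (intro that[of g]) (auto simp: proper_colouring_def)
qed

lemma arrowsE:
  fixes c :: "nat set \<Rightarrow> bool"
  assumes "arrows n G"
  obtains h b where "\<And>v. v \<in> verts G \<Longrightarrow> h v < n"
    and "\<And>u v. {u, v} \<in> edges G \<Longrightarrow> h u \<noteq> h v \<and> c {h u, h v} = b"
proof -
  obtain b where "maps_to G (colour_class n c b)"
    using assms unfolding arrows_def by blast
  then obtain h where h: "\<And>v. v \<in> verts G \<Longrightarrow> h v \<in> verts (colour_class n c b)"
    and e: "\<And>u v. {u, v} \<in> edges G \<Longrightarrow> {h u, h v} \<in> edges (colour_class n c b)"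
    using maps_toE by metis
  show thesis
  proof (rule that[of h b])
    show "h v < n" if "v \<in> verts G" for v
      using h[OF that] by (simp add: colour_class_def)
    show "h u \<noteq> h v \<and> c {h u, h v} = b" if "{u, v} \<in> edges G" for u v
      using e[OF that] by (simp add: colour_class_def)
  qed
qed

lemma arrows_mono:
  assumes "arrows m G" "m \<le> n"
  shows "arrows n G"
  unfolding arrows_def
proof
  fix c
  obtain b where b: "maps_to G (colour_class m c b)"
    using assms unfolding arrows_def by blast
  have "maps_to (colour_class m c b) (colour_class n c b)"
    using assms(2) nsets_mono[of "{..<m}" "{..<n}" 2] by (intro maps_to_mono) (auto simp: colour_class_def)
  with b show "\<exists>b. maps_to G (colour_class n c b)"
    using maps_to_trans by blast
qed

lemma arrows_maps_to: "arrows n H \<Longrightarrow> maps_to G H \<Longrightarrow> arrows n G"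
  unfolding arrows_def using maps_to_trans by blast

subsection \<open>The chromatic Ramsey number as a homomorphism Ramsey number\<close>

text \<open>A colouring \<open>c\<close> of the complete graph pulls back to \<open>F\<close> along
  an optimal proper colouring \<open>g\<close>. A monochromatic copy of \<open>G\<close> in
  \<open>F\<close>, followed by \<open>g\<close>, is a homomorphism into a class of
  \<open>c\<close>.\<close>

lemma ramsey_for_imp_arrows:
  assumes "simple_graph F" "simple_graph G" "ramsey_for F G"
  shows "arrows (chromatic_number F) G"
  unfolding arrows_def
proof
  fix c :: "nat set \<Rightarrow> bool"
  obtain g where g: "\<And>v. v \<in> verts F \<Longrightarrow> g v < chromatic_number F"
    "\<And>u v. {u, v} \<in> edges F \<Longrightarrow> g u \<noteq> g v"
    using optimal_colouringE[OF assms(1)] by blast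
  obtain H b where "copy_of H G" and H: "subgraph_of H F" "\<And>e. e \<in> edges H \<Longrightarrow> c (g ` e) = b"
    using assms(3)[unfolded ramsey_for_def, rule_format, of "\<lambda>e. c (g ` e)"] by blast
  then obtain f where f: "H = relabel f G"
    unfolding copy_of_def by blast
  have e: "{f u, f v} \<in> edges H" if "{u, v} \<in> edges G" for u v
    using imageI[OF that, of "image f"] by (simp add: f relabel_def)
  have "maps_to G (colour_class (chromatic_number F) c b)"
  proof (rule maps_toI[where f = "g \<circ> f"])
    fix v assume "v \<in> verts G"
    then have "f v \<in> verts F"
      using H(1) by (auto simp: subgraph_of_def f relabel_def)
    then show "(g \<circ> f) v \<in> verts (colour_class (chromatic_number F) c b)"
      by (simp add: colour_class_def g)
  next
    fix u v assume "{u, v} \<in> edges G"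
    from e[OF this] have "{f u, f v} \<in> edges F" "c (g ` {f u, f v}) = b"
      using H(1) H(2)[of "{f u, f v}"] unfolding subgraph_of_def by blast+
    then show "{(g \<circ> f) u, (g \<circ> f) v} \<in> edges (colour_class (chromatic_number F) c b)"
      using simple_graph_edgeD[OF assms(1)] by (simp add: colour_class_def g)
  qed
  then show "\<exists>b. maps_to G (colour_class (chromatic_number F) c b)" ..
qed

text \<open>Ramsey's theorem for pairs, with colours from an arbitrary finite set so that whole
  patterns (sets of index pairs) can serve as colours.\<close>

lemma ramsey_finite_colours:
  fixes D :: "'d set"
  assumes "finite D"
  shows "\<exists>M. \<forall>f :: nat set \<Rightarrow> 'd. range f \<subseteq> D \<longrightarrow>
           (\<exists>S\<subseteq>{..<M}. card S = q \<and> (\<exists>d. \<forall>x\<in>S. \<forall>y\<in>S. x < y \<longrightarrow> f {x, y} = d))"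
proof -
  obtain k where k: "bij_betw k D {0..<card D}"
    using assms ex_bij_betw_finite_nat by blast
  obtain M :: nat where M: "partn_lst {..<M} (replicate (card D) q) 2"
    using ramsey_full[of "replicate (card D) q" 2] by blast
  have "\<exists>S\<subseteq>{..<M}. card S = q \<and> (\<exists>d. \<forall>x\<in>S. \<forall>y\<in>S. x < y \<longrightarrow> f {x, y} = d)"
    if f: "range f \<subseteq> D" for f :: "nat set \<Rightarrow> 'd"
  proof -
    have "k \<circ> f \<in> nsets {..<M} 2 \<rightarrow> {..<card D}"
      using bij_betwE[OF k] f by (auto simp: image_subset_iff)
    then obtain i where "i < card D" "monochromatic {..<M} q 2 (k \<circ> f) i"
      using M by (auto simp: partn_lst_def)
    then obtain S where S: "S \<in> nsets {..<M} q" and i: "(k \<circ> f) ` nsets S 2 \<subseteq> {i}"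
      unfolding monochromatic_def by blast
    have "f {x, y} = the_inv_into D k i" if "x \<in> S" "y \<in> S" "x < y" for x y
    proof -
      have "k (f {x, y}) = i"
        using i that by (auto simp: image_subset_iff)
      then show ?thesis
        using k f by (metis bij_betw_imp_inj_on rangeI subsetD the_inv_into_f_f)
    qed
    then show ?thesis
      using S by (auto simp: nsets_def)
  qed
  then show ?thesis by blast
qed

text \<open>The host graph is a complete \<open>n\<close>-partite graph whose parts \<open>{a * n + i | a}\<close> are the residue
  classes. Colouring a pair \<open>x < y\<close> by the whole pattern of colours between \<open>x * n + i\<close> and
  \<open>y * n + j\<close>, ordinary Ramsey yields a long increasing sequence on which the pattern is constant;
  cutting it into \<open>n\<close> consecutive blocks gives a blow-up of a 2-coloured complete graph.\<close>

lemma arrows_imp_ramsey_for: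
  fixes G :: "'a graph"
  assumes G: "simple_graph G" "verts G \<noteq> {}" and arr: "arrows n G"
  shows "\<exists>F :: nat graph. simple_graph F \<and> chromatic_number F = n \<and> ramsey_for F G"
proof -
  define t where "t = card (verts G)"
  have t: "t > 0"
    using G by (simp add: t_def simple_graph_def card_gt_0_iff)
  have n: "n > 0"
    using G(2) by (rule_tac arrowsE[OF arr]) fastforce
  obtain M where M: "\<And>f :: nat set \<Rightarrow> (nat \<times> nat) set. range f \<subseteq> Pow ({..<n} \<times> {..<n}) \<Longrightarrow>
      \<exists>S\<subseteq>{..<M}. card S = n * t \<and> (\<exists>d. \<forall>x\<in>S. \<forall>y\<in>S. x < y \<longrightarrow> f {x, y} = d)"
    using ramsey_finite_colours[of "Pow ({..<n} \<times> {..<n})" "n * t"] by auto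
  have "M > 0"
  proof -
    obtain S where "S \<subseteq> {..<M}" "card S = n * t"
      using M[of "\<lambda>_. {}"] by auto
    then show ?thesis
      using n t by (cases M) auto
  qed
  define F :: "nat graph" where
    "F = ({..<M * n}, {e \<in> nsets {..<M * n} 2. inj_on (\<lambda>v. v mod n) e})"
  have F: "simple_graph F"
    by (auto simp: simple_graph_def F_def)
  have "chromatic_number F \<le> n"
    unfolding chromatic_number_le_iff[OF F]
    by (rule maps_toI[where f = "\<lambda>v. v mod n"]) (use n in \<open>auto simp: F_def complete_on_def\<close>)
  moreover have "n \<le> chromatic_number F"
  proof -
    obtain g where "\<And>v. v \<in> verts F \<Longrightarrow> g v < chromatic_number F"
      and g_edge: "\<And>u v. {u, v} \<in> edges F \<Longrightarrow> g u \<noteq> g v"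
      using optimal_colouringE[OF F] by blast
    then have g: "\<And>v. v < M * n \<Longrightarrow> g v < chromatic_number F"
      by (simp add: F_def)
    \<comment> \<open>The numbers below \<open>n\<close> represent all residue classes, so they form
      an \<open>n\<close>-clique of \<open>F\<close> and force \<open>n\<close> colours.\<close>
    have M1: "v < M * n" if "v < n" for v
      using that \<open>M > 0\<close> by (cases M) auto
    have "inj_on g {..<n}"
    proof (rule inj_onI, rule ccontr)
      fix u v assume "u \<in> {..<n}" "v \<in> {..<n}" "g u = g v" "u \<noteq> v"
      then have "{u, v} \<in> edges F"
        by (auto simp: F_def M1)
      with g_edge \<open>g u = g v\<close> show False by blast
    qed
    moreover have "g ` {..<n} \<subseteq> {..<chromatic_number F}"
      using g M1 by auto
    ultimately show ?thesis
      using card_inj_on_le[of g "{..<n}" "{..<chromatic_number F}"] by simp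
  qed
  moreover have "ramsey_for F G"
    unfolding ramsey_for_def
  proof
    fix c :: "nat set \<Rightarrow> bool"
    define f where
      "f e = {(i, j). i < n \<and> j < n \<and> c {Min e * n + i, Max e * n + j}}" for e
    have f: "range f \<subseteq> Pow ({..<n} \<times> {..<n})"
      by (auto simp: f_def)
    obtain S where S: "S \<subseteq> {..<M}" "card S = n * t"
      and "\<exists>D. \<forall>x\<in>S. \<forall>y\<in>S. x < y \<longrightarrow> f {x, y} = D"
      using M[OF f] by (elim exE conjE) (rule that, assumption+, rule exI)
    then obtain D where "\<forall>x\<in>S. \<forall>y\<in>S. x < y \<longrightarrow> f {x, y} = D"
      by (elim exE)
    then have D: "f {x, y} = D" if "x \<in> S" "y \<in> S" "x < y" for x y
      using that by simp
    have cD: "c {x * n + i, y * n + j} \<longleftrightarrow> (i, j) \<in> D"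
      if "x \<in> S" "y \<in> S" "x < y" "i < n" "j < n" for x y i j
      unfolding D[OF that(1-3), symmetric] using that by (simp add: f_def)
    define s where "s k = sorted_list_of_set S ! k" for k
    have finS: "finite S"
      using S(1) finite_subset by blast
    have s_in: "s k \<in> S" if "k < n * t" for k
      using that S(2) finS nth_mem[of k "sorted_list_of_set S"] by (simp add: s_def)
    have s_less: "s k < s l" if "k < l" "l < n * t" for k l
      unfolding s_def using that S
      by (intro sorted_wrt_nth_less[OF strict_sorted_list_of_set]) simp_all
    \<comment> \<open>The constant pattern \<open>D\<close> induces a colouring of the complete
      graph on \<open>n\<close> vertices, reading each pair in increasing order.\<close>
    obtain h b where h: "\<And>v. v \<in> verts G \<Longrightarrow> h v < n"
      and hc: "\<And>u v. {u, v} \<in> edges G \<Longrightarrow>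
                 h u \<noteq> h v \<and> ((Min {h u, h v}, Max {h u, h v}) \<in> D) = b"
      by (rule arrowsE[OF arr, of "\<lambda>e. (Min e, Max e) \<in> D"], rule that)
    obtain r where r: "bij_betw r (verts G) {0..<t}"
      using G(1) ex_bij_betw_finite_nat unfolding simple_graph_def t_def by blast
    then have r_less: "r v < t" if "v \<in> verts G" for v
      using that bij_betw_apply[OF r that] by simp
    \<comment> \<open>Block \<open>h v\<close> of the sequence has length \<open>t\<close>; the
      offset \<open>r v\<close> separates vertices of \<open>G\<close> with the same image under
      \<open>h\<close>.\<close>
    define p where "p v = h v * t + r v" for v
    have p_less: "p v < n * t" if "v \<in> verts G" for v
    proof -
      have "p v < Suc (h v) * t"
        using r_less[OF that] by (simp add: p_def)
      also have "\<dots> \<le> n * t"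
        using h[OF that] by (intro mult_right_mono) auto
      finally show ?thesis .
    qed
    define g where "g v = s (p v) * n + h v" for v
    have g_mod: "g v mod n = h v" and g_div: "g v div n = s (p v)" if "v \<in> verts G" for v
      using h[OF that] by (simp_all add: g_def)
    have g_less: "g v < M * n" if "v \<in> verts G" for v
    proof -
      have "g v < Suc (s (p v)) * n"
        using h[OF that] by (simp add: g_def)
      also have "\<dots> \<le> M * n"
        using s_in[OF p_less[OF that]] S(1) by (intro mult_right_mono) auto
      finally show ?thesis .
    qed
    have "inj_on g (verts G)"
    proof (rule inj_onI)
      fix u v assume uv: "u \<in> verts G" "v \<in> verts G" "g u = g v"
      then have "s (p u) = s (p v)"
        using g_div by metis
      then have "p u = p v"
        using s_less p_less uv by (metis linorder_neqE_nat less_irrefl)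
      then have "p u mod t = p v mod t"
        by simp
      then have "r u = r v"
        using r_less uv by (simp add: p_def)
      then show "u = v"
        using r uv by (meson bij_betw_imp_inj_on inj_onD)
    qed
    then have copy: "copy_of (relabel g G) G"
      unfolding copy_of_def by blast
    \<comment> \<open>Blocks follow the order of \<open>h\<close>, so \<open>h u < h v\<close> gives
      \<open>s (p u) < s (p v)\<close>, and the colour is read off \<open>D\<close> in the
      orientation used for \<open>h\<close>.\<close>
    have cb_less: "c {g u, g v} = b" if "{u, v} \<in> edges G" "h u < h v" for u v
    proof -
      note V = simple_graph_edgeD[OF G(1) that(1)]
      have "p u < Suc (h u) * t"
        using r_less[OF V(1)] by (simp add: p_def)
      also have "\<dots> \<le> h v * t"
        using that(2) by (intro mult_right_mono) auto
      also have "\<dots> \<le> p v"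
        by (simp add: p_def)
      finally have "s (p u) < s (p v)"
        using s_less p_less V by blast
      then have "c {g u, g v} \<longleftrightarrow> (h u, h v) \<in> D"
        unfolding g_def using V h by (intro cD s_in p_less) auto
      then show ?thesis
        using hc[OF that(1)] that(2) by simp
    qed
    have cb: "c {g u, g v} = b" if "{u, v} \<in> edges G" for u v
      using cb_less[of u v] cb_less[of v u] that hc[OF that]
      by (metis insert_commute linorder_neqE_nat)
    have gF: "{g u, g v} \<in> edges F" if "{u, v} \<in> edges G" for u v
    proof -
      note V = simple_graph_edgeD[OF G(1) that]
      have "g u mod n \<noteq> g v mod n"
        using hc[OF that] g_mod V by simp
      then show ?thesis
        using g_less V by (auto simp: F_def)
    qed
    have "edges (relabel g G) \<subseteq> edges F"
      using gF by (blast elim: relabel_edgeE[OF G(1)])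
    moreover have "verts (relabel g G) \<subseteq> verts F"
      using g_less by (auto simp: relabel_def F_def)
    ultimately have "subgraph_of (relabel g G) F"
      unfolding subgraph_of_def by blast
    moreover have "\<forall>e\<in>edges (relabel g G). c e = b"
    proof
      fix e assume "e \<in> edges (relabel g G)"
      then obtain u v where "{u, v} \<in> edges G" "e = {g u, g v}"
        by (rule relabel_edgeE[OF G(1)])
      then show "c e = b"
        using cb by simp
    qed
    ultimately show "\<exists>H. copy_of H G \<and> subgraph_of H F \<and> (\<exists>b. \<forall>e\<in>edges H. c e = b)"
      using copy by blast
  qed
  ultimately show ?thesis
    using F by (intro exI[of _ F]) simp
qed

theorem chromatic_ramsey_eq_Least_arrows:
  assumes "simple_graph G" "verts G \<noteq> {}"
  shows "chromatic_ramsey G = (LEAST n. arrows n G)"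
proof -
  have "(\<exists>F :: nat graph. simple_graph F \<and> chromatic_number F = n \<and> ramsey_for F G) \<longleftrightarrow> arrows n G" for n
    using arrows_imp_ramsey_for[OF assms] ramsey_for_imp_arrows[OF _ assms(1)] by blast
  then show ?thesis
    unfolding chromatic_ramsey_def by simp
qed

subsection \<open>Hall ratio of tensor products\<close>

text \<open>The Hall ratio of \<open>G\<close>, the maximum of \<open>|S| / \<alpha>(G[S])\<close>, is at least \<open>k\<close>.\<close>

definition hall_ratio_ge :: "nat \<Rightarrow> 'a graph \<Rightarrow> bool" where
  "hall_ratio_ge k G \<longleftrightarrow>
     (\<exists>S\<subseteq>verts G. S \<noteq> {} \<and> (\<forall>I\<subseteq>S. indep I (edges G) \<longrightarrow> k * card I \<le> card S))"

definition closed_nbhd :: "'a graph \<Rightarrow> 'a set \<Rightarrow> 'a set" where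
  "closed_nbhd G A = A \<union> {v. \<exists>u\<in>A. {u, v} \<in> edges G}"

definition tensor_product :: "'a graph \<Rightarrow> 'b graph \<Rightarrow> ('a \<times> 'b) graph" where
  "tensor_product G H =
     (verts G \<times> verts H, {{(u, x), (v, y)} |u v x y. {u, v} \<in> edges G \<and> {x, y} \<in> edges H})"

lemma tensor_product_edge_iff:
  "{(u, x), (v, y)} \<in> edges (tensor_product G H) \<longleftrightarrow> {u, v} \<in> edges G \<and> {x, y} \<in> edges H"
  by (auto simp: tensor_product_def doubleton_eq_iff insert_commute)

lemma simple_tensor_product:
  assumes "simple_graph G" "simple_graph H"
  shows "simple_graph (tensor_product G H)"
  using assms simple_graph_edgeD[OF assms(1)] simple_graph_edgeD[OF assms(2)]
  by (auto simp: simple_graph_def tensor_product_def)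

lemma tensor_product_maps_to:
  shows "maps_to (tensor_product G H) G" "maps_to (tensor_product G H) H"
proof -
  show "maps_to (tensor_product G H) G"
    by (rule maps_toI[where f = fst])
      (auto simp: tensor_product_edge_iff, auto simp: tensor_product_def)
  show "maps_to (tensor_product G H) H"
    by (rule maps_toI[where f = snd])
      (auto simp: tensor_product_edge_iff, auto simp: tensor_product_def)
qed

text \<open>The classes of an optimal colouring cut the witness \<open>S\<close> into independent
  sets, each containing at most a fraction \<open>1 / k\<close> of \<open>S\<close>.\<close>

lemma hall_ratio_ge_le_chromatic_number:
  assumes G: "simple_graph G" and k: "hall_ratio_ge k G"
  shows "k \<le> chromatic_number G"
proof -
  obtain S where S: "S \<subseteq> verts G" "S \<noteq> {}"
    and I: "\<And>I. I \<subseteq> S \<Longrightarrow> indep I (edges G) \<Longrightarrow> k * card I \<le> card S"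
    using k unfolding hall_ratio_ge_def by blast
  have fin: "finite S"
    using G S(1) finite_subset unfolding simple_graph_def by blast
  obtain g where g: "\<And>v. v \<in> verts G \<Longrightarrow> g v < chromatic_number G"
    "\<And>u v. {u, v} \<in> edges G \<Longrightarrow> g u \<noteq> g v"
    using optimal_colouringE[OF G] by blast
  have "card S = (\<Sum>i<chromatic_number G. \<Sum>v\<in>{v \<in> S. g v = i}. 1)"
    by (subst sum.group) (use fin S(1) g(1) in auto)
  then have "k * card S = (\<Sum>i<chromatic_number G. k * card {v \<in> S. g v = i})"
    by (simp add: sum_distrib_left)
  also have "\<dots> \<le> (\<Sum>i<chromatic_number G. card S)"
    using g(2) by (intro sum_mono I) (auto simp: indep_def, metis)
  finally show ?thesis
    using S(2) fin card_gt_0_iff[of S] by simp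
qed

text \<open>In a smallest set \<open>S\<close> witnessing the Hall ratio, every independent set expands by a factor
  \<open>k\<close>: otherwise deleting its closed neighbourhood from \<open>S\<close> gives a smaller witness.\<close>

lemma hall_ratio_ge_expansion:
  assumes G: "simple_graph G" and k: "hall_ratio_ge k G"
  obtains S where "S \<subseteq> verts G" "S \<noteq> {}" "finite S"
    "\<And>A. A \<subseteq> S \<Longrightarrow> indep A (edges G) \<Longrightarrow> k * card A \<le> card (S \<inter> closed_nbhd G A)"
proof -
  define W where "W S \<longleftrightarrow> S \<subseteq> verts G \<and> S \<noteq> {} \<and>
    (\<forall>I\<subseteq>S. indep I (edges G) \<longrightarrow> k * card I \<le> card S)" for S
  obtain S where W: "W S" and min: "\<And>S'. W S' \<Longrightarrow> card S \<le> card S'"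
    using ex_has_least_nat[of W _ card] k unfolding hall_ratio_ge_def W_def[symmetric] by metis
  then have S: "S \<subseteq> verts G" "S \<noteq> {}"
    and I: "\<And>I. I \<subseteq> S \<Longrightarrow> indep I (edges G) \<Longrightarrow> k * card I \<le> card S"
    unfolding W_def by blast+
  have fin: "finite S"
    using G S(1) finite_subset unfolding simple_graph_def by blast
  have "k * card A \<le> card (S \<inter> closed_nbhd G A)"
    if A: "A \<subseteq> S" "indep A (edges G)" for A
  proof (rule ccontr)
    let ?N = "S \<inter> closed_nbhd G A"
    assume "\<not> ?thesis"
    then have less: "card ?N < k * card A"
      by simp
    have card_diff: "card (S - ?N) + card ?N = card S"
      using fin by (metis Int_lower1 add.commute card_Diff_subset card_mono finite_Int le_add_diff_inverse)
    have "A \<noteq> {}"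
      using less by auto
    then have "?N \<noteq> {}"
      using A(1) by (auto simp: closed_nbhd_def)
    then have "card ?N > 0"
      using fin by (simp add: card_gt_0_iff)
    have "W (S - ?N)"
      unfolding W_def
    proof (intro conjI allI impI)
      show "S - ?N \<subseteq> verts G"
        using S(1) by blast
      \<comment> \<open>If \<open>?N\<close> were all of \<open>S\<close>, then \<open>less\<close>
        would contradict the bound \<open>I\<close> for \<open>A\<close>.\<close>
      show "S - ?N \<noteq> {}"
        using less I[OF A] card_diff by (metis add_0 card.empty leD)
      fix J assume J: "J \<subseteq> S - ?N" "indep J (edges G)"
      \<comment> \<open>\<open>J\<close> avoids the closed neighbourhood of \<open>A\<close>, so the
        bound on \<open>S\<close> applies to the union; subtracting
        \<open>card ?N < k * card A\<close> leaves the bound for \<open>J\<close>.\<close>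
      have "indep (J \<union> A) (edges G)"
        unfolding indep_def
      proof (intro ballI impI notI)
        fix v w assume vw: "v \<in> J \<union> A" "w \<in> J \<union> A" "v \<noteq> w" and e: "{v, w} \<in> edges G"
        then have "{w, v} \<in> edges G"
          by (simp add: insert_commute)
        with vw e J A show False
          unfolding indep_def closed_nbhd_def by blast
      qed
      then have "k * card (J \<union> A) \<le> card S"
        using J A by (intro I) auto
      moreover have "card (J \<union> A) = card J + card A"
        using J A fin by (intro card_Un_disjoint) (auto simp: closed_nbhd_def intro: finite_subset)
      ultimately show "k * card J \<le> card (S - ?N)"
        using less card_diff by (simp add: distrib_left)
    qed
    from min[OF this] card_diff \<open>card ?N > 0\<close> show False
      by simp
  qed
  with S fin show thesis
    by (rule that)
qed

lemma card_pairs_snd: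
  assumes "U \<subseteq> S \<times> T" "finite S" "finite T"
  shows "card U = (\<Sum>x\<in>S. card {y. (x, y) \<in> U})"
proof -
  have "U = (SIGMA x:S. {y. (x, y) \<in> U})"
    using assms(1) by auto
  moreover have "card (SIGMA x:S. {y. (x, y) \<in> U}) = (\<Sum>x\<in>S. card {y. (x, y) \<in> U})"
    using assms by (intro card_SigmaI) (auto intro: finite_subset[of _ T])
  ultimately show ?thesis by simp
qed

lemma card_pairs_fst:
  assumes "U \<subseteq> S \<times> T" "finite S" "finite T"
  shows "card U = (\<Sum>y\<in>T. card {x. (x, y) \<in> U})"
proof -
  have "card U = card (prod.swap ` U)"
    by (simp add: card_image inj_on_subset[OF inj_swap])
  also have "\<dots> = (\<Sum>y\<in>T. card {x. (y, x) \<in> prod.swap ` U})"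
    using assms by (intro card_pairs_snd) auto
  also have "\<dots> = (\<Sum>y\<in>T. card {x. (x, y) \<in> U})"
    by (intro sum.cong refl arg_cong[where f = card]) force
  finally show ?thesis .
qed

text \<open>Zhu's argument for the fractional Hedetniemi conjecture: split an independent set \<open>U\<close> of the
  product into a part whose rows are independent in \<open>G\<close> and a part whose columns are independent in
  \<open>H\<close>. Expanding the rows, respectively the columns, gives disjoint subsets of \<open>S \<times> T\<close>.\<close>

lemma hall_ratio_ge_tensor_product:
  assumes G: "simple_graph G" "hall_ratio_ge k G" and H: "simple_graph H" "hall_ratio_ge k H"
  shows "hall_ratio_ge k (tensor_product G H)"
proof -
  obtain S where S: "S \<subseteq> verts G" "S \<noteq> {}" "finite S"
    and S_exp: "\<And>A. A \<subseteq> S \<Longrightarrow> indep A (edges G) \<Longrightarrow> k * card A \<le> card (S \<inter> closed_nbhd G A)"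
    using hall_ratio_ge_expansion[OF G] by blast
  obtain T where T: "T \<subseteq> verts H" "T \<noteq> {}" "finite T"
    and T_exp: "\<And>A. A \<subseteq> T \<Longrightarrow> indep A (edges H) \<Longrightarrow> k * card A \<le> card (T \<inter> closed_nbhd H A)"
    using hall_ratio_ge_expansion[OF H] by blast
  have "k * card U \<le> card (S \<times> T)"
    if U: "U \<subseteq> S \<times> T" and ind: "indep U (edges (tensor_product G H))" for U
  proof -
    have U_edge: False
      if "(u, x) \<in> U" "(v, y) \<in> U" "{u, v} \<in> edges G" "{x, y} \<in> edges H" for u v x y
      using ind that simple_graph_edgeD(3)[OF G(1) that(3)]
      unfolding indep_def by (metis prod.inject tensor_product_edge_iff)
    define A where "A = {(x, y) \<in> U. \<not> (\<exists>x'. (x', y) \<in> U \<and> {x, x'} \<in> edges G)}"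
    define B where "B = U - A"
    define row where "row y = {x. (x, y) \<in> A}" for y
    define col where "col x = {y. (x, y) \<in> B}" for x
    define A' where "A' = {(x, y) \<in> S \<times> T. x \<in> closed_nbhd G (row y)}"
    define B' where "B' = {(x, y) \<in> S \<times> T. y \<in> closed_nbhd H (col x)}"
    have sub: "A \<subseteq> S \<times> T" "B \<subseteq> S \<times> T" "A' \<subseteq> S \<times> T" "B' \<subseteq> S \<times> T"
      using U by (auto simp: A_def B_def A'_def B'_def)
    note finST = finite_cartesian_product[OF S(3) T(3)]
    have row_ind: "indep (row y) (edges G)" for y
      by (auto simp: indep_def row_def A_def)
    \<comment> \<open>A point \<open>(x, y)\<close> of \<open>B\<close> has a
      \<open>G\<close>-neighbour \<open>(x', y)\<close> of \<open>U\<close> in its row. An edge of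
      \<open>H\<close> from \<open>y\<close> to \<open>y'\<close> in column \<open>x\<close> would
      make \<open>(x', y)\<close> and \<open>(x, y')\<close> adjacent inside
      \<open>U\<close>.\<close>
    have col_ind: "indep (col x) (edges H)" for x
      unfolding indep_def
    proof (intro ballI impI notI)
      fix y y' assume y: "y \<in> col x" "y' \<in> col x" and e: "{y, y'} \<in> edges H"
      then obtain x' where "(x', y) \<in> U" "{x, x'} \<in> edges G" and "(x, y') \<in> U"
        by (auto simp: col_def B_def A_def)
      with e show False
        using U_edge[of x' y x y'] by (simp add: insert_commute)
    qed
    have "k * card A = (\<Sum>y\<in>T. k * card (row y))"
      using card_pairs_fst[OF sub(1) S(3) T(3)] by (simp add: row_def sum_distrib_left)
    also have "\<dots> \<le> (\<Sum>y\<in>T. card (S \<inter> closed_nbhd G (row y)))"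
      using sub(1) row_ind by (intro sum_mono S_exp) (auto simp: row_def)
    also have "\<dots> = (\<Sum>y\<in>T. card {x. (x, y) \<in> A'})"
      by (intro sum.cong refl arg_cong[where f = card]) (auto simp: A'_def)
    also have "\<dots> = card A'"
      using card_pairs_fst[OF sub(3) S(3) T(3)] by simp
    finally have A_le: "k * card A \<le> card A'" .
    have "k * card B = (\<Sum>x\<in>S. k * card (col x))"
      using card_pairs_snd[OF sub(2) S(3) T(3)] by (simp add: col_def sum_distrib_left)
    also have "\<dots> \<le> (\<Sum>x\<in>S. card (T \<inter> closed_nbhd H (col x)))"
      using sub(2) col_ind by (intro sum_mono T_exp) (auto simp: col_def)
    also have "\<dots> = (\<Sum>x\<in>S. card {y. (x, y) \<in> B'})"
      by (intro sum.cong refl arg_cong[where f = card]) (auto simp: B'_def)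
    also have "\<dots> = card B'"
      using card_pairs_snd[OF sub(4) S(3) T(3)] by simp
    finally have B_le: "k * card B \<le> card B'" .
    \<comment> \<open>A common point yields a product edge inside \<open>U\<close>: if it lies in
      \<open>A\<close>, move along its column to a point of \<open>B\<close> and then along that
      point's row; otherwise its row neighbour in \<open>A\<close> is adjacent to its column
      neighbour in \<open>B\<close>.\<close>
    have "A' \<inter> B' = {}"
    proof (rule ccontr)
      assume "A' \<inter> B' \<noteq> {}"
      then obtain x y where x: "x \<in> closed_nbhd G (row y)" and y: "y \<in> closed_nbhd H (col x)"
        by (auto simp: A'_def B'_def)
      from x consider (A) "(x, y) \<in> A" | (nA) x' where "(x', y) \<in> A" "{x', x} \<in> edges G"
        by (auto simp: closed_nbhd_def row_def)
      then show False
      proof cases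
        case A
        then have "(x, y) \<notin> B" "(x, y) \<in> U"
          by (auto simp: A_def B_def)
        then obtain y' where y': "(x, y') \<in> B" "{y', y} \<in> edges H"
          using y by (auto simp: closed_nbhd_def col_def)
        then obtain x' where "(x', y') \<in> U" "{x, x'} \<in> edges G"
          by (auto simp: B_def A_def)
        then show False
          using U_edge[of x y x' y'] y'(2) \<open>(x, y) \<in> U\<close> by (simp add: insert_commute)
      next
        case nA
        then have "(x', y) \<in> U" "(x, y) \<notin> U"
          by (auto simp: A_def)
        then obtain y' where "(x, y') \<in> U" "{y', y} \<in> edges H"
          using y by (auto simp: closed_nbhd_def col_def B_def)
        then show False
          using U_edge[of x' y x y'] nA(2) \<open>(x', y) \<in> U\<close> by (simp add: insert_commute)
      qed
    qed
    then have "card A' + card B' = card (A' \<union> B')"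
      using sub finST by (metis card_Un_disjoint finite_subset)
    also have "\<dots> \<le> card (S \<times> T)"
      using sub finST by (intro card_mono) auto
    finally have "card A' + card B' \<le> card (S \<times> T)" .
    moreover have "card U = card A + card B"
    proof -
      have "A \<subseteq> U"
        by (auto simp: A_def)
      then have "A \<union> B = U" "A \<inter> B = {}"
        by (auto simp: B_def)
      then show ?thesis
        using sub finST by (metis card_Un_disjoint finite_subset)
    qed
    ultimately show ?thesis
      using A_le B_le by (simp add: distrib_left)
  qed
  moreover have "S \<times> T \<subseteq> verts (tensor_product G H)" "S \<times> T \<noteq> {}"
    using S T by (auto simp: tensor_product_def)
  ultimately show ?thesis
    unfolding hall_ratio_ge_def by blast
qed

section \<open>Relabelled graphs and common homomorphic preimages\<close>

lemma relabel_edge_iff: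
  assumes "inj f"
  shows "{f u, f v} \<in> edges (relabel f G) \<longleftrightarrow> {u, v} \<in> edges G"
proof -
  have "{f u, f v} = f ` e \<longleftrightarrow> {u, v} = e" for e
    using inj_image_eq_iff[OF assms, of "{u, v}" e] by simp
  then show ?thesis
    by (auto simp: relabel_def image_iff)
qed

lemma simple_relabel:
  assumes "inj f" "simple_graph G"
  shows "simple_graph (relabel f G)"
  using assms unfolding simple_graph_def relabel_def nsets_def
  by (auto simp: card_image inj_on_subset)

lemma relabel_maps_to:
  assumes "inj f" "simple_graph G"
  shows "maps_to (relabel f G) G"
proof (rule maps_toI[where f = "inv f"])
  show "inv f v \<in> verts G" if "v \<in> verts (relabel f G)" for v
    using that assms by (auto simp: relabel_def)
  show "{inv f u, inv f v} \<in> edges G" if uv: "{u, v} \<in> edges (relabel f G)" for u v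
  proof -
    obtain a b where ab: "{a, b} \<in> edges G" "{u, v} = {f a, f b}"
      using uv by (rule relabel_edgeE[OF assms(2)])
    have "{inv f u, inv f v} = inv f ` {u, v}"
      by simp
    also have "\<dots> = {a, b}"
      unfolding ab(2) using assms(1) by simp
    finally show ?thesis
      using ab(1) by simp
  qed
qed

lemma hall_ratio_ge_relabel:
  assumes f: "inj f" and k: "hall_ratio_ge k G"
  shows "hall_ratio_ge k (relabel f G)"
proof -
  obtain S where S: "S \<subseteq> verts G" "S \<noteq> {}"
    and I: "\<And>I. I \<subseteq> S \<Longrightarrow> indep I (edges G) \<Longrightarrow> k * card I \<le> card S"
    using k unfolding hall_ratio_ge_def by blast
  have "k * card I \<le> card (f ` S)"
    if I_sub: "I \<subseteq> f ` S" and I_ind: "indep I (edges (relabel f G))" for I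
  proof -
    obtain J where J: "J \<subseteq> S" "I = f ` J"
      using I_sub subset_image_iff by metis
    have "indep J (edges G)"
      using I_ind f unfolding indep_def J(2) by (simp add: relabel_edge_iff inj_eq)
    then show ?thesis
      using I[of J] J f by (simp add: card_image inj_on_subset)
  qed
  moreover have "f ` S \<subseteq> verts (relabel f G)" "f ` S \<noteq> {}"
    using S by (auto simp: relabel_def)
  ultimately show ?thesis
    unfolding hall_ratio_ge_def by blast
qed

lemma hall_ratio_ge_complete_on:
  assumes "finite A" "A \<noteq> {}"
  shows "hall_ratio_ge (card A) (complete_on A)"
proof -
  have "card A * card I \<le> card A" if "I \<subseteq> A" "indep I (nsets A 2)" for I
  proof -
    have "card I \<le> 1"
      using that assms card_le_Suc0_iff_eq[of I] finite_subset[of I A] unfolding indep_def by auto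
    then show ?thesis by simp
  qed
  with assms show ?thesis
    unfolding hall_ratio_ge_def complete_on_def by (intro exI[of _ A]) auto
qed

text \<open>Iterating the tensor product keeps the Hall ratio at least \<open>k\<close>, while the
  projections supply the homomorphisms.\<close>

lemma exists_common_preimage:
  fixes \<H> :: "nat graph set"
  assumes "finite \<H>" "k > 0" "\<And>H. H \<in> \<H> \<Longrightarrow> simple_graph H \<and> hall_ratio_ge k H"
  shows "\<exists>G :: nat graph. simple_graph G \<and> hall_ratio_ge k G \<and> (\<forall>H\<in>\<H>. maps_to G H)"
  using assms(1,3)
proof (induction \<H>)
  case empty
  show ?case
    using hall_ratio_ge_complete_on[of "{..<k}"] \<open>k > 0\<close>
    by (intro exI[of _ "complete_on {..<k}"]) (auto simp: simple_complete_on)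
next
  case (insert H \<H>)
  then obtain G :: "nat graph"
    where G: "simple_graph G" "hall_ratio_ge k G" "\<And>H. H \<in> \<H> \<Longrightarrow> maps_to G H"
    by (metis insertI2)
  have H: "simple_graph H" "hall_ratio_ge k H"
    using insert.prems by auto
  \<comment> \<open>\<open>prod_encode\<close> returns the product to vertices of type
    \<open>nat\<close>, as the induction requires.\<close>
  let ?P = "relabel prod_encode (tensor_product G H)"
  have "maps_to ?P G" "maps_to ?P H"
    using relabel_maps_to[OF inj_prod_encode simple_tensor_product[OF G(1) H(1)]]
      tensor_product_maps_to maps_to_trans by blast+
  then have "\<forall>H'\<in>insert H \<H>. maps_to ?P H'"
    using G(3) maps_to_trans by blast
  moreover have "simple_graph ?P"
    using G H by (intro simple_relabel simple_tensor_product inj_prod_encode)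
  moreover have "hall_ratio_ge k ?P"
    using G H by (intro hall_ratio_ge_relabel hall_ratio_ge_tensor_product inj_prod_encode)
  ultimately show ?case by blast
qed

subsection \<open>A graph with quadratic chromatic Ramsey number\<close>

text \<open>An independent \<open>k\<close>-set of the class \<open>True\<close> is a
  \<open>k\<close>-clique of the class \<open>False\<close>. If there is none, independent sets of
  \<open>True\<close> have fewer than \<open>k\<close> of the \<open>k * k\<close> vertices, so the
  whole vertex set is a witness.\<close>

lemma colour_class_hall_ratio_ge:
  assumes "k > 0"
  shows "\<exists>b. hall_ratio_ge k (colour_class (k * k) c b)"
proof (cases "\<exists>I\<subseteq>{..<k * k}. indep I (edges (colour_class (k * k) c True)) \<and> k \<le> card I")
  case True
  then obtain I where I: "I \<subseteq> {..<k * k}" "indep I (edges (colour_class (k * k) c True))" "k \<le> card I"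
    by blast
  obtain S where "S \<subseteq> I" "card S = k"
    using obtain_subset_with_card_n[OF I(3)] by blast
  with I have S: "S \<subseteq> {..<k * k}" "indep S (edges (colour_class (k * k) c True))" "k = card S"
    using smaller_indep by auto
  then have "finite S" "S \<noteq> {}"
    using \<open>k > 0\<close> by (auto intro: finite_subset)
  have "card S * card I \<le> card S"
    if "I \<subseteq> S" "indep I (edges (colour_class (k * k) c False))" for I
  proof -
    have "x = y" if "x \<in> I" "y \<in> I" for x y
      using \<open>I \<subseteq> S\<close> S(1,2) that \<open>indep I _\<close> unfolding indep_def colour_class_def
      by simp blast
    then have "card I \<le> 1"
      using \<open>I \<subseteq> S\<close> \<open>finite S\<close> card_le_Suc0_iff_eq[of I] finite_subset[of I S] by auto
    then show ?thesis by simp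
  qed
  with S \<open>S \<noteq> {}\<close> have "hall_ratio_ge k (colour_class (k * k) c False)"
    unfolding hall_ratio_ge_def by (intro exI[of _ S]) (auto simp: colour_class_def)
  then show ?thesis ..
next
  case False
  then have "k * card I \<le> card {..<k * k}"
    if "I \<subseteq> {..<k * k}" "indep I (edges (colour_class (k * k) c True))" for I
    using that by (force intro: mult_left_mono)
  moreover have "0 \<in> {..<k * k}"
    using \<open>k > 0\<close> by simp
  then have "{..<k * k} \<noteq> {}"
    by blast
  ultimately have "hall_ratio_ge k (colour_class (k * k) c True)"
    unfolding hall_ratio_ge_def by (intro exI[of _ "{..<k * k}"]) (auto simp: colour_class_def)
  then show ?thesis ..
qed

lemma exists_arrows_square:
  assumes "k > 0"
  obtains G :: "nat graph" where "simple_graph G" "chromatic_number G = k" "arrows (k * k) G"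
proof -
  \<comment> \<open>Including the complete graph forces chromatic number at most \<open>k\<close> on
    a common preimage; its Hall ratio gives the reverse inequality.\<close>
  define \<H> where "\<H> = insert (complete_on {..<k})
    {H. \<exists>c b. H = colour_class (k * k) c b \<and> hall_ratio_ge k H}"
  \<comment> \<open>There are infinitely many functions \<open>c\<close>, but only finitely many
    graphs on \<open>{..<k * k}\<close>.\<close>
  have "\<H> \<subseteq> insert (complete_on {..<k}) ({{..<k * k}} \<times> Pow (nsets {..<k * k} 2))"
    by (auto simp: \<H>_def colour_class_def)
  then have "finite \<H>"
    by (rule finite_subset) (simp add: finite_imp_finite_nsets)
  moreover have "simple_graph H \<and> hall_ratio_ge k H" if "H \<in> \<H>" for H
    using that hall_ratio_ge_complete_on[of "{..<k}"] assms
    by (auto simp: \<H>_def simple_complete_on simple_colour_class)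
  ultimately obtain G :: "nat graph"
    where G: "simple_graph G" "hall_ratio_ge k G" "\<forall>H\<in>\<H>. maps_to G H"
    using exists_common_preimage[of \<H>, OF _ assms] by blast
  have "chromatic_number G \<le> k"
    using G by (simp add: chromatic_number_le_iff \<H>_def)
  moreover have "k \<le> chromatic_number G"
    using hall_ratio_ge_le_chromatic_number G by blast
  moreover have "arrows (k * k) G"
    unfolding arrows_def
  proof
    fix c
    obtain b where "hall_ratio_ge k (colour_class (k * k) c b)"
      using colour_class_hall_ratio_ge[OF assms] by blast
    then have "colour_class (k * k) c b \<in> \<H>"
      unfolding \<H>_def by blast
    with G show "\<exists>b. maps_to G (colour_class (k * k) c b)"
      by blast
  qed
  ultimately show thesis
    using G that by simp
qed

subsection \<open>Disjoint unions with a clique\<close>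

text \<open>The clique starts right above the largest vertex of \<open>G\<close>, so the union is
  disjoint and stays on natural numbers.\<close>

definition disjoint_clique :: "nat graph \<Rightarrow> nat \<Rightarrow> nat graph" where
  "disjoint_clique G i =
     (let A = {Suc (Max (verts G))..<Suc (Max (verts G)) + i} in (verts G \<union> A, edges G \<union> nsets A 2))"

context
  fixes G :: "nat graph"
  assumes G: "simple_graph G"
begin

lemma disjoint_clique_disjoint:
  "v \<in> verts G \<Longrightarrow> v < Suc (Max (verts G))"
  using G by (simp add: simple_graph_def less_Suc_eq_le)

lemma simple_disjoint_clique: "simple_graph (disjoint_clique G i)"
  using G unfolding simple_graph_def disjoint_clique_def Let_def nsets_def by auto

lemma disjoint_clique_mono: "i \<le> j \<Longrightarrow> maps_to (disjoint_clique G i) (disjoint_clique G j)"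
  by (rule maps_to_mono) (auto simp: disjoint_clique_def Let_def nsets_def)

text \<open>The disjoint union is a coproduct: homomorphisms from the two parts glue, after shifting
  the clique back to start at 0.\<close>

lemma disjoint_clique_maps_to_iff:
  "maps_to (disjoint_clique G i) H \<longleftrightarrow> maps_to G H \<and> maps_to (complete_on {..<i}) H"
proof (intro iffI conjI)
  assume H: "maps_to (disjoint_clique G i) H"
  have "maps_to G (disjoint_clique G i)"
    by (rule maps_to_mono) (auto simp: disjoint_clique_def Let_def)
  then show "maps_to G H"
    using H by (rule maps_to_trans)
  have "maps_to (complete_on {..<i}) (disjoint_clique G i)"
    by (rule maps_toI[where f = "\<lambda>v. Suc (Max (verts G)) + v"])
      (auto simp: disjoint_clique_def complete_on_def Let_def)
  then show "maps_to (complete_on {..<i}) H"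
    using H by (rule maps_to_trans)
next
  assume H: "maps_to G H \<and> maps_to (complete_on {..<i}) H"
  obtain f where f: "\<And>v. v \<in> verts G \<Longrightarrow> f v \<in> verts H"
    "\<And>u v. {u, v} \<in> edges G \<Longrightarrow> {f u, f v} \<in> edges H"
    using H maps_toE by metis
  obtain g where g: "\<And>v. v \<in> verts (complete_on {..<i}) \<Longrightarrow> g v \<in> verts H"
    "\<And>u v. {u, v} \<in> edges (complete_on {..<i}) \<Longrightarrow> {g u, g v} \<in> edges H"
    using H maps_toE by metis
  let ?m = "Suc (Max (verts G))"
  let ?h = "\<lambda>v. if v < ?m then f v else g (v - ?m)"
  show "maps_to (disjoint_clique G i) H"
  proof (rule maps_toI[where f = ?h])
    fix v assume "v \<in> verts (disjoint_clique G i)"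
    then show "?h v \<in> verts H"
      using f(1)[of v] g(1)[of "v - ?m"] disjoint_clique_disjoint[of v]
      by (auto simp: disjoint_clique_def complete_on_def Let_def split: if_splits)
  next
    fix u v assume "{u, v} \<in> edges (disjoint_clique G i)"
    then consider "{u, v} \<in> edges G" | "{u, v} \<in> nsets {?m..<?m + i} 2"
      by (auto simp: disjoint_clique_def Let_def)
    then show "{?h u, ?h v} \<in> edges H"
    proof cases
      case 1
      then have "u < ?m" "v < ?m"
        using simple_graph_edgeD[OF G 1] disjoint_clique_disjoint by blast+
      then show ?thesis
        using f(2)[OF 1] by simp
    next
      case 2
      then have "\<not> u < ?m" "\<not> v < ?m" "{u - ?m, v - ?m} \<in> edges (complete_on {..<i})"
        by (auto simp: complete_on_def)
      then show ?thesis
        using g(2) by simp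
    qed
  qed
qed

text \<open>Any \<open>n\<close> colours that suffice for \<open>G\<close> satisfy
  \<open>i \<le> n\<close>, so they also suffice for the clique.\<close>

lemma chromatic_number_disjoint_clique:
  assumes "i \<le> chromatic_number G"
  shows "chromatic_number (disjoint_clique G i) = chromatic_number G"
proof -
  have "maps_to (complete_on {..<i}) (complete_on {..<n})" if "i \<le> n" for n :: nat
    using that by (intro maps_to_mono) (auto simp: complete_on_def nsets_def)
  then have "chromatic_number (disjoint_clique G i) \<le> n \<longleftrightarrow> chromatic_number G \<le> n" for n
    unfolding chromatic_number_le_iff[OF simple_disjoint_clique] disjoint_clique_maps_to_iff
    using chromatic_number_le_iff[OF G] assms order_trans by blast
  then show ?thesis
    by (meson order_antisym order_refl)
qed

end

section \<open>Ramsey bounds and the extension by one vertex\<close>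

text \<open>\<open>G\<close> maps into the complete graph on \<open>k\<close> vertices, which maps
  into a monochromatic \<open>k\<close>-set. The bound is uniform in \<open>G\<close>, so it gives
  both existence of the least \<open>n\<close> and finiteness of the set of values.\<close>

lemma arrows_Ramsey:
  obtains N where "\<And>G :: 'a graph. simple_graph G \<Longrightarrow> chromatic_number G \<le> k \<Longrightarrow> arrows N G"
proof -
  obtain M :: nat where M: "partn_lst {..<M} (replicate 2 k) 2"
    using ramsey_full[of "replicate 2 k" 2] by blast
  have "arrows M G" if G: "simple_graph G" "chromatic_number G \<le> k" for G :: "'a graph"
    unfolding arrows_def
  proof
    fix c :: "nat set \<Rightarrow> bool"
    let ?f = "\<lambda>e. if c e then 1 else 0 :: nat"
    have "?f \<in> nsets {..<M} 2 \<rightarrow> {..<2}"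
      by auto
    then obtain i where "i < 2" "monochromatic {..<M} k 2 ?f i"
      using M by (force simp: partn_lst_def)
    then obtain S where S: "S \<in> nsets {..<M} k" and i: "?f ` nsets S 2 \<subseteq> {i}"
      unfolding monochromatic_def by blast
    have col: "c e = (i = 1)" if "e \<in> nsets S 2" for e
    proof -
      have "?f e \<in> {i}"
        using that i by blast
      then show ?thesis by (auto split: if_splits)
    qed
    have "finite S" "card S = k" "S \<subseteq> {..<M}"
      using S by (auto simp: nsets_def)
    then obtain s where s: "bij_betw s {0..<k} S"
      using ex_bij_betw_nat_finite by blast
    have "maps_to (complete_on {..<k}) (colour_class M c (i = 1))"
    proof (rule maps_toI[where f = s])
      show "s v \<in> verts (colour_class M c (i = 1))" if "v \<in> verts (complete_on {..<k})" for v
        using that bij_betw_apply[OF s, of v] \<open>S \<subseteq> {..<M}\<close>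
        by (auto simp: complete_on_def colour_class_def)
      show "{s u, s v} \<in> edges (colour_class M c (i = 1))"
        if "{u, v} \<in> edges (complete_on {..<k})" for u v
      proof -
        have "s u \<in> S" "s v \<in> S" "s u \<noteq> s v"
          using that bij_betw_apply[OF s] bij_betw_imp_inj_on[OF s]
          by (auto simp: complete_on_def inj_on_eq_iff)
        then show ?thesis
          using \<open>S \<subseteq> {..<M}\<close> col[of "{s u, s v}"] by (auto simp: colour_class_def)
      qed
    qed
    moreover have "maps_to G (complete_on {..<k})"
      using G chromatic_number_le_iff by blast
    ultimately show "\<exists>b. maps_to G (colour_class M c b)"
      using maps_to_trans by blast
  qed
  then show thesis
    by (rule that)
qed

text \<open>Vertices sent outside \<open>H'\<close> are redirected to a fixed vertex
  \<open>w\<close>; this affects no edge, since endpoints of edges of \<open>H\<close> lie in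
  \<open>H'\<close>.\<close>

lemma maps_to_drop_isolated:
  assumes "maps_to G H" "verts H' \<noteq> {}" "edges H \<subseteq> edges H'"
    and "\<And>u v. {u, v} \<in> edges H \<Longrightarrow> u \<in> verts H'"
    and "simple_graph G"
  shows "maps_to G H'"
proof -
  obtain w where w: "w \<in> verts H'"
    using assms(2) by blast
  obtain f where f: "\<And>u v. {u, v} \<in> edges G \<Longrightarrow> {f u, f v} \<in> edges H"
    using assms(1) maps_toE by metis
  let ?g = "\<lambda>v. if f v \<in> verts H' then f v else w"
  show ?thesis
  proof (rule maps_toI[where f = ?g])
    show "?g v \<in> verts H'" for v
      using w by simp
    fix u v assume "{u, v} \<in> edges G"
    then have e: "{f u, f v} \<in> edges H" "{f v, f u} \<in> edges H"
      using f by (simp_all add: insert_commute)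
    then show "{?g u, ?g v} \<in> edges H'"
      using assms(3,4) by auto
  qed
qed

text \<open>In colour \<open>b\<close> the new vertex raises the clique number by at most one; in
  the other colour it is isolated, so not even the union with an \<open>i\<close>-clique maps
  there.\<close>

lemma not_arrows_disjoint_clique_Suc:
  assumes G: "simple_graph G" and n: "arrows n G" "n > 0"
    and not: "\<not> arrows n (disjoint_clique G i)"
  shows "\<not> arrows (Suc n) (disjoint_clique G (Suc i))"
proof -
  obtain c where c: "\<And>b. \<not> maps_to (disjoint_clique G i) (colour_class n c b)"
    using not unfolding arrows_def by blast
  obtain b where b: "maps_to G (colour_class n c b)"
    using n(1) unfolding arrows_def by blast
  then have no_clique: "\<not> maps_to (complete_on {..<i}) (colour_class n c b)"
    using c disjoint_clique_maps_to_iff[OF G] by blast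
  define c' where "c' e = (if n \<in> e then b else c e)" for e
  have "\<not> maps_to (complete_on {..<Suc i}) (colour_class (Suc n) c' b)"
  proof
    assume "maps_to (complete_on {..<Suc i}) (colour_class (Suc n) c' b)"
    then obtain f
      where f': "\<And>v. v \<in> verts (complete_on {..<Suc i}) \<Longrightarrow> f v \<in> verts (colour_class (Suc n) c' b)"
      and e': "\<And>u v. {u, v} \<in> edges (complete_on {..<Suc i}) \<Longrightarrow>
                 {f u, f v} \<in> edges (colour_class (Suc n) c' b)"
      by (rule maps_toE) (rule that)
    have f: "f v < Suc n" if "v < Suc i" for v
      using f'[of v] that by (simp add: complete_on_def colour_class_def)
    have e: "{f u, f v} \<in> edges (colour_class (Suc n) c' b)"
      if "u < Suc i" "v < Suc i" "u \<noteq> v" for u v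
      using e'[of u v] that by (simp add: complete_on_def)
    have inj: "f u \<noteq> f v" if "u < Suc i" "v < Suc i" "u \<noteq> v" for u v
      using e[OF that] by (simp add: colour_class_def)
    \<comment> \<open>At most one vertex is sent to \<open>n\<close>; \<open>w\<close> is that
      vertex, or arbitrary if there is none. Then \<open>?g\<close> enumerates the remaining
      \<open>i\<close> vertices by skipping \<open>w\<close>.\<close>
    obtain w where w: "w < Suc i" and wn: "\<And>v. v < Suc i \<Longrightarrow> v \<noteq> w \<Longrightarrow> f v \<noteq> n"
      using inj by (metis lessI)
    let ?g = "\<lambda>v. f (if v < w then v else Suc v)"
    have "maps_to (complete_on {..<i}) (colour_class n c b)"
    proof (rule maps_toI[where f = ?g])
      have g: "(if v < w then v else Suc v) < Suc i" "(if v < w then v else Suc v) \<noteq> w" if "v < i" for v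
        using that w by auto
      then have g_less: "?g v < n" if "v < i" for v
        using f wn that by (metis less_SucE)
      then show "?g v \<in> verts (colour_class n c b)" if "v \<in> verts (complete_on {..<i})" for v
        using that by (simp add: complete_on_def colour_class_def)
      fix u v assume "{u, v} \<in> edges (complete_on {..<i})"
      then have uv: "u < i" "v < i" "u \<noteq> v"
        by (auto simp: complete_on_def)
      then have "{?g u, ?g v} \<in> edges (colour_class (Suc n) c' b)"
        using g by (intro e) auto
      then show "{?g u, ?g v} \<in> edges (colour_class n c b)"
        using g_less[OF uv(1)] g_less[OF uv(2)]
        by (simp add: colour_class_def c'_def)
    qed
    with no_clique show False ..
  qed
  then have "\<not> maps_to (disjoint_clique G (Suc i)) (colour_class (Suc n) c' b)"
    using disjoint_clique_maps_to_iff[OF G] by blast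
  moreover have "\<not> maps_to (disjoint_clique G (Suc i)) (colour_class (Suc n) c' (\<not> b))"
  proof
    assume "maps_to (disjoint_clique G (Suc i)) (colour_class (Suc n) c' (\<not> b))"
    then have "maps_to (disjoint_clique G i) (colour_class (Suc n) c' (\<not> b))"
      using disjoint_clique_mono[OF G, of i "Suc i"] maps_to_trans by fastforce
    then have "maps_to (disjoint_clique G i) (colour_class n c (\<not> b))"
    proof (rule maps_to_drop_isolated)
      have *: "e \<in> nsets {..<n} 2" if "e \<in> nsets {..<Suc n} 2" "n \<notin> e" for e
        using that by (auto simp: nsets_def lessThan_Suc)
      show "edges (colour_class (Suc n) c' (\<not> b)) \<subseteq> edges (colour_class n c (\<not> b))"
        using * by (auto simp: colour_class_def c'_def split: if_splits)
      then show "u \<in> verts (colour_class n c (\<not> b))"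
        if "{u, v} \<in> edges (colour_class (Suc n) c' (\<not> b))" for u v
        using that simple_graph_edgeD[OF simple_colour_class] by blast
      show "verts (colour_class n c (\<not> b)) \<noteq> {}"
        using n(2) by (auto simp: colour_class_def)
    qed (rule simple_disjoint_clique[OF G])
    with c show False by blast
  qed
  ultimately have "\<not> maps_to (disjoint_clique G (Suc i)) (colour_class (Suc n) c' b')" for b'
    by (cases "b' = b") auto
  then show ?thesis
    unfolding arrows_def by blast
qed

text \<open>Iterated lexicographic products of the 2-colouring of a complete graph on five vertices into
  two pentagons.\<close>

lemma exists_colouring_small_cliques:
  "\<exists>c :: nat set \<Rightarrow> bool. \<forall>S\<subseteq>{..<5 ^ m}. \<forall>b. (\<forall>x\<in>S. \<forall>y\<in>S. x \<noteq> y \<longrightarrow> c {x, y} = b) \<longrightarrow> card S \<le> 2 ^ m"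
proof (induction m)
  case 0
  show ?case
    using card_mono[of "{..<1 :: nat}"] by auto
next
  case (Suc m)
  then obtain c :: "nat set \<Rightarrow> bool" where c: "\<And>S b. S \<subseteq> {..<5 ^ m} \<Longrightarrow>
      (\<And>x y. x \<in> S \<Longrightarrow> y \<in> S \<Longrightarrow> x \<noteq> y \<Longrightarrow> c {x, y} = b) \<Longrightarrow> card S \<le> 2 ^ m"
    by metis
  \<comment> \<open>Differences 1 and 4 form one pentagon on \<open>{..<5}\<close>, differences 2
    and 3 the other; both are triangle-free.\<close>
  define pent :: "nat set \<Rightarrow> bool" where "pent e \<longleftrightarrow> Max e - Min e = 1 \<or> Max e - Min e = 4" for e
  have pent: "card S \<le> 2"
    if S: "S \<subseteq> {..<5}" and mono: "\<And>x y. x \<in> S \<Longrightarrow> y \<in> S \<Longrightarrow> x \<noteq> y \<Longrightarrow> pent {x, y} = b" for S b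
  proof (rule ccontr)
    assume "\<not> card S \<le> 2"
    then have "nsets S 3 \<noteq> {}"
      by (simp add: nsets_eq_empty_iff)
    then obtain x y z where xyz: "x \<in> S" "y \<in> S" "z \<in> S" "x < y" "y < z"
      unfolding ordered_nsets_3_eq by blast
    have dist: "(v - u = 1 \<or> v - u = 4) = b" if "u \<in> S" "v \<in> S" "u < v" for u v
      using mono[of u v] that by (simp add: pent_def max_def min_def)
    have "z < 5"
      using S xyz by auto
    then show False
      using dist[of x y] dist[of y z] dist[of x z] xyz by (cases b) auto
  qed
  define q :: nat where "q = 5 ^ m"
  \<comment> \<open>Pairs with equal quotients lie in one block of size \<open>q\<close> and take
    their colour from \<open>c\<close>; pairs from different blocks take it from
    \<open>pent\<close>.\<close>
  define c' where
    "c' e = (if card ((\<lambda>x. x div q) ` e) = 1 then c ((\<lambda>x. x mod q) ` e) else pent ((\<lambda>x. x div q) ` e))" for e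
  have q: "q > 0"
    by (simp add: q_def)
  have card: "card S \<le> 2 ^ Suc m"
    if S: "S \<subseteq> {..<5 ^ Suc m}" and mono: "\<And>x y. x \<in> S \<Longrightarrow> y \<in> S \<Longrightarrow> x \<noteq> y \<Longrightarrow> c' {x, y} = b" for S b
  proof -
    have fin: "finite S"
      using S finite_subset by blast
    let ?D = "(\<lambda>x. x div q) ` S"
    have "card ?D \<le> 2"
    proof (rule pent)
      show "?D \<subseteq> {..<5}"
        using S by (auto simp: q_def less_mult_imp_div_less)
      show "pent {x, y} = b" if xy: "x \<in> ?D" "y \<in> ?D" "x \<noteq> y" for x y
      proof -
        obtain u v where uv: "u \<in> S" "v \<in> S" "x = u div q" "y = v div q"
          using xy(1,2) by (elim imageE)
        then have "c' {u, v} = pent {x, y}"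
          using \<open>x \<noteq> y\<close> by (simp add: c'_def)
        then show ?thesis
          using mono[of u v] uv \<open>x \<noteq> y\<close> by auto
      qed
    qed
    moreover have "card {x \<in> S. x div q = d} \<le> 2 ^ m" for d
    proof -
      have inj: "inj_on (\<lambda>x. x mod q) {x \<in> S. x div q = d}"
        by (intro inj_onI) (metis (mono_tags, lifting) div_mult_mod_eq mem_Collect_eq)
      have "card ((\<lambda>x. x mod q) ` {x \<in> S. x div q = d}) \<le> 2 ^ m"
      proof (rule c)
        show "(\<lambda>x. x mod q) ` {x \<in> S. x div q = d} \<subseteq> {..<5 ^ m}"
          using q by (auto simp: q_def)
        show "c {x, y} = b" if xy: "x \<in> (\<lambda>x. x mod q) ` {x \<in> S. x div q = d}"
          "y \<in> (\<lambda>x. x mod q) ` {x \<in> S. x div q = d}" "x \<noteq> y" for x y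
        proof -
          obtain u v where uv: "u \<in> S" "v \<in> S" "u div q = d" "v div q = d" "x = u mod q" "y = v mod q"
            using xy(1,2) by auto
          then have "c' {u, v} = c {x, y}"
            by (simp add: c'_def)
          then show ?thesis
            using mono[of u v] uv \<open>x \<noteq> y\<close> by auto
        qed
      qed
      then show ?thesis
        by (simp add: card_image[OF inj])
    qed
    then have "(\<Sum>d\<in>?D. card {x \<in> S. x div q = d}) \<le> card ?D * 2 ^ m"
      using sum_bounded_above[of ?D "\<lambda>d. card {x \<in> S. x div q = d}" "2 ^ m"] by simp
    moreover have "card S = (\<Sum>d\<in>?D. \<Sum>x\<in>{x \<in> S. x div q = d}. 1)"
      by (subst sum.group) (use fin in auto)
    ultimately have "card S \<le> card ?D * 2 ^ m"
      by simp
    also have "\<dots> \<le> 2 * 2 ^ m"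
      using \<open>card ?D \<le> 2\<close> by (intro mult_right_mono) auto
    finally show ?thesis by simp
  qed
  show ?case
    by (intro exI[of _ c'] allI impI) (rule card, auto)
qed

text \<open>A homomorphism from an \<open>i\<close>-clique into a colour class is injective, and the
  product colouring on \<open>5 ^ m\<close> vertices has no monochromatic clique that large.\<close>

lemma not_arrows_disjoint_clique:
  assumes "simple_graph G" "n \<le> 5 ^ m" "2 ^ m < i"
  shows "\<not> arrows n (disjoint_clique G i)"
proof
  assume "arrows n (disjoint_clique G i)"
  then have arr: "arrows (5 ^ m) (complete_on {..<i})"
    using arrows_mono[OF _ assms(2)] arrows_maps_to disjoint_clique_maps_to_iff[OF assms(1)]
      maps_to_mono[OF order_refl order_refl] by blast
  obtain c :: "nat set \<Rightarrow> bool" where c: "\<And>S b. S \<subseteq> {..<5 ^ m} \<Longrightarrow>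
      (\<And>x y. x \<in> S \<Longrightarrow> y \<in> S \<Longrightarrow> x \<noteq> y \<Longrightarrow> c {x, y} = b) \<Longrightarrow> card S \<le> 2 ^ m"
    using exists_colouring_small_cliques by metis
  obtain h b where h: "\<And>v. v \<in> verts (complete_on {..<i}) \<Longrightarrow> h v < 5 ^ m"
    and e: "\<And>u v. {u, v} \<in> edges (complete_on {..<i}) \<Longrightarrow> h u \<noteq> h v \<and> c {h u, h v} = b"
    by (rule arrowsE[OF arr, of c], rule that)
  have e': "h u \<noteq> h v \<and> c {h u, h v} = b" if "u < i" "v < i" "u \<noteq> v" for u v
    using e[of u v] that by (simp add: complete_on_def)
  have "card (h ` {..<i}) = i"
    using e' by (subst card_image) (auto intro!: inj_onI)
  moreover have "card (h ` {..<i}) \<le> 2 ^ m"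
  proof (rule c)
    show "h ` {..<i} \<subseteq> {..<5 ^ m}"
      using h by (auto simp: complete_on_def)
    show "c {x, y} = b" if "x \<in> h ` {..<i}" "y \<in> h ` {..<i}" "x \<noteq> y" for x y
      using that e' by auto
  qed
  ultimately show False
    using assms(3) by simp
qed

section \<open>Choice of parameters and counting of values\<close>

text \<open>With \<open>2 ^ n \<le> k < 2 ^ Suc n\<close> and \<open>m = n - 1\<close>, the square
  of \<open>k\<close> is at most \<open>4 ^ (m + 2)\<close>, which \<open>5 ^ m\<close> exceeds from
  \<open>m = 14\<close> on.\<close>

lemma exists_power_between:
  fixes k :: nat
  assumes "2 ^ 16 \<le> k"
  obtains m where "k * k \<le> 5 ^ m" "2 ^ m \<le> k div 2"
proof -
  have "k > 0"
    using order.strict_trans2[OF _ assms] by (metis zero_less_numeral zero_less_power)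
  then obtain n where n: "2 ^ n \<le> k" "k < 2 ^ Suc n"
    using ex_power_ivl1[of 2 k] by (metis One_nat_def Suc_eq_plus1 Suc_leI order_refl)
  have "15 \<le> n"
  proof (rule ccontr)
    assume "\<not> 15 \<le> n"
    then have "2 ^ Suc n \<le> (2 ^ 16 :: nat)"
      by (intro power_increasing) auto
    then show False
      using n(2) assms by linarith
  qed
  then obtain d where d: "n = 15 + d"
    using le_Suc_ex by blast
  define m where "m = 14 + d"
  have "k * k \<le> 2 ^ Suc n * 2 ^ Suc n"
    using n(2) by (intro mult_mono) auto
  also have "\<dots> = 4 ^ (16 + d)"
    unfolding d by (simp flip: power_mult_distrib)
  also have "\<dots> = 4 ^ 16 * 4 ^ d"
    by (rule power_add)
  \<comment> \<open>The numerical fact behind the threshold is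
    \<open>4 ^ 16 \<le> 5 ^ 14\<close>.\<close>
  also have "\<dots> \<le> 5 ^ 14 * 5 ^ d"
    by (intro mult_mono power_mono) auto
  also have "\<dots> = 5 ^ m"
    unfolding m_def by (rule power_add[symmetric])
  finally have "k * k \<le> 5 ^ m" .
  moreover have "2 ^ m \<le> k div 2"
  proof -
    have "(2 :: nat) ^ n = 2 * 2 ^ m"
      unfolding d m_def by (simp add: power_add)
    with n(1) have "2 * 2 ^ m \<le> k"
      by linarith
    then show ?thesis by linarith
  qed
  ultimately show thesis
    by (rule that)
qed

text \<open>Write the least value for \<open>i\<close> as \<open>Suc l\<close>. Then
  \<open>n \<le> l\<close>, so \<open>l\<close> arrows \<open>G\<close> but not the union with an
  \<open>i\<close>-clique, and the one-vertex extension shows that \<open>Suc l\<close> fails for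
  \<open>Suc i\<close>.\<close>

lemma chromatic_ramsey_disjoint_clique_less:
  assumes G: "simple_graph G" and k: "arrows n G" "n > 0"
    and ne: "verts G \<noteq> {}" and i: "\<not> arrows n (disjoint_clique G i)"
  shows "chromatic_ramsey (disjoint_clique G i) < chromatic_ramsey (disjoint_clique G (Suc i))"
proof -
  let ?L = "\<lambda>i. LEAST n. arrows n (disjoint_clique G i)"
  have ex: "\<exists>n. arrows n (disjoint_clique G i)" for i
    using arrows_Ramsey[of "chromatic_number (disjoint_clique G i)"] simple_disjoint_clique[OF G]
    by (metis order_refl)
  have ne': "verts (disjoint_clique G i) \<noteq> {}" for i
    using ne by (simp add: disjoint_clique_def Let_def)
  have "n < ?L i"
    using i arrows_mono LeastI_ex[OF ex] by (meson not_less)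
  then obtain l where l: "?L i = Suc l" "n \<le> l"
    by (cases "?L i") auto
  have "\<not> arrows l (disjoint_clique G i)"
    using not_less_Least[of l "\<lambda>n. arrows n (disjoint_clique G i)"] l(1) by simp
  then have "\<not> arrows (?L i) (disjoint_clique G (Suc i))"
    unfolding l(1) using arrows_mono[OF k(1) l(2)] k(2) l(2)
    by (intro not_arrows_disjoint_clique_Suc[OF G]) auto
  then have "?L i < ?L (Suc i)"
    using arrows_mono LeastI_ex[OF ex] by (meson not_less)
  then show ?thesis
    using chromatic_ramsey_eq_Least_arrows[OF simple_disjoint_clique[OF G] ne'] by simp
qed

lemma chromatic_number_pos_imp_verts:
  assumes "simple_graph G" "chromatic_number G > 0"
  shows "verts G \<noteq> {}"
proof
  assume "verts G = {}"
  then have "maps_to G (complete_on {..<0})"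
    by (intro maps_toI[where f = "\<lambda>_. 0"]) (use simple_graph_edgeD[OF assms(1)] in auto)
  then show False
    using chromatic_number_le_iff[OF assms(1)] assms(2) by fastforce
qed

text \<open>Needed because \<open>card\<close> of an infinite set is 0, which would void the lower
  bound on the count.\<close>

lemma finite_chromatic_ramsey_values:
  assumes "k > 0"
  shows "finite {chromatic_ramsey G | G :: 'a graph. simple_graph G \<and> chromatic_number G = k}"
proof -
  obtain N where N: "\<And>G :: 'a graph. simple_graph G \<Longrightarrow> chromatic_number G \<le> k \<Longrightarrow> arrows N G"
    by (rule arrows_Ramsey, rule that)
  have "chromatic_ramsey G \<le> N" if "simple_graph G" "chromatic_number G = k" for G :: "'a graph"
  proof -
    have "verts G \<noteq> {}"
      using that assms chromatic_number_pos_imp_verts[of G] by simp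
    then show ?thesis
      using N that by (simp add: chromatic_ramsey_eq_Least_arrows Least_le)
  qed
  then show ?thesis
    by (auto intro!: finite_subset[OF _ finite_atMost[of N]])
qed

lemma card_chromatic_ramsey_values:
  assumes k: "2 ^ 16 \<le> k"
  shows "k \<le> 2 * card {chromatic_ramsey G | G :: nat graph. simple_graph G \<and> chromatic_number G = k}"
    (is "_ \<le> 2 * card ?V")
proof -
  obtain m where m: "k * k \<le> 5 ^ m" "2 ^ m \<le> k div 2"
    by (rule exists_power_between[OF k], rule that)
  have k0: "k > 0"
    by (rule less_le_trans[OF _ k]) simp
  obtain G :: "nat graph" where G: "simple_graph G" "chromatic_number G = k" "arrows (k * k) G"
    by (rule exists_arrows_square[OF k0], rule that)
  have ne: "verts G \<noteq> {}"
    using chromatic_number_pos_imp_verts[OF G(1)] G(2) k0 by simp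
  \<comment> \<open>Clique sizes start at \<open>Suc (2 ^ m)\<close>, just beyond the largest
    monochromatic clique allowed by the product colouring. For \<open>j < k - 2 ^ m\<close> they
    stay at most \<open>k\<close>, which keeps the chromatic number equal to
    \<open>k\<close>.\<close>
  define r where "r j = chromatic_ramsey (disjoint_clique G (Suc (2 ^ m) + j))" for j
  have "r j < r (Suc j)" for j
  proof -
    have "\<not> arrows (k * k) (disjoint_clique G (Suc (2 ^ m) + j))"
      by (rule not_arrows_disjoint_clique[OF G(1) m(1)]) simp
    then show ?thesis
      unfolding r_def add_Suc_right using k0
      by (intro chromatic_ramsey_disjoint_clique_less[OF G(1,3) _ ne]) simp_all
  qed
  then have "strict_mono r"
    by (simp add: strict_mono_Suc_iff)
  then have inj: "inj_on r {..<k - 2 ^ m}"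
    using strict_mono_imp_inj_on inj_on_subset by blast
  have "r j \<in> ?V" if "j < k - 2 ^ m" for j
  proof -
    have "chromatic_number (disjoint_clique G (Suc (2 ^ m) + j)) = k"
      using chromatic_number_disjoint_clique[OF G(1)] G(2) that by simp
    then show ?thesis
      unfolding r_def using simple_disjoint_clique[OF G(1)] by blast
  qed
  then have "card (r ` {..<k - 2 ^ m}) \<le> card ?V"
    by (intro card_mono finite_chromatic_ramsey_values k0) auto
  then have "k - 2 ^ m \<le> card ?V"
    by (simp add: card_image[OF inj])
  then show ?thesis
    using m(2) by linarith
qed

theorem theorem1p1:
  "\<exists>c :: real. c > 0 \<and> (\<exists>k0 :: nat. \<forall>k \<ge> k0.
     real (card {chromatic_ramsey G | G :: nat graph.
                   simple_graph G \<and> chromatic_number G = k}) \<ge> c * real k)"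
proof (rule exI[of _ "1 / 2"], rule conjI)
  show "\<exists>k0 :: nat. \<forall>k \<ge> k0. real (card {chromatic_ramsey G | G :: nat graph.
                   simple_graph G \<and> chromatic_number G = k}) \<ge> 1 / 2 * real k"
    (is "\<exists>k0. \<forall>k \<ge> k0. real (?card k) \<ge> _")
  proof (rule exI[of _ "2 ^ 16"], intro allI impI)
    fix k :: nat assume "2 ^ 16 \<le> k"
    then have "real k \<le> real (2 * ?card k)"
      by (intro of_nat_mono card_chromatic_ramsey_values)
    then show "real (?card k) \<ge> 1 / 2 * real k"
      by simp
  qed
qed simp

end
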